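(* Let $G$ be a broken sun graph of order $n$ which has a perfect matching and such that $2$ is an eigenvalue of the Laplacian matrix $L(G)$. Then there exist a real number $r\neq 0$ and an eigenvector $X=(x_1,\ldots,x_n)^t$ of $L(G)$ corresponding to the eigenvalue $2$ such that $x_i\in\{-r,r\}$ for all $i=1,\ldots,n$.
   Context: All graphs are finite, undirected, with no loops or multiple edges. The Laplacian matrix of $G$ is $L(G)=D(G)-A(G)$, where $D(G)$ is the diagonal matrix of vertex degrees and $A(G)$ is the adjacency matrix. A unicyclic graph is a connected graph whose number of edges equals its number of vertices. The sun graph of order $2m$ ($m\ge 3$) is the cycle $C_m$ with one pendant vertex attached to each vertex of the cycle. A broken sun graph is a unicyclic subgraph of a sun graph (i.e. a cycle with at most one pendant vertex attached to each cycle vertex). *)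

theory Defs
  imports
    "Graph_Theory.Graph_Theory"
    "Jordan_Normal_Form.Char_Poly"
begin

text \<open>
  Finite simple graphs are the locale \<^locale>\<open>pair_graph\<close>: finite, loop-free digraphs without
  parallel arcs whose arc relation is symmetric. Each undirected edge is thus a pair of opposite
  arcs, and the out-degree of a vertex is its degree.
  \<open>Digraph_Component.connected\<close> is qualified because the topological \<open>connected\<close> has the same
  base name.
\<close>

definition uedges :: "'a pair_pre_digraph \<Rightarrow> 'a set set" where
  "uedges G = (\<lambda>(u, v). {u, v}) ` parcs G"

definition unicyclic :: "'a pair_pre_digraph \<Rightarrow> bool" where
  "unicyclic G \<longleftrightarrow>
     pair_graph G \<and> Digraph_Component.connected (with_proj G) \<and>
     card (uedges G) = card (pverts G)"

text \<open>
  The sun graph of order \<open>2 * m\<close>: the vertices \<open>Inl i\<close> form the cycle, and \<open>Inr i\<close> is the pendant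
  vertex attached to \<open>Inl i\<close>. It is only meaningful for \<open>m \<ge> 3\<close>.
\<close>

definition sun_graph :: "nat \<Rightarrow> (nat + nat) pair_pre_digraph" where
  "sun_graph m =
     (let A = {(Inl i, Inl (Suc i mod m)) |i. i < m} \<union> {(Inl i, Inr i) |i. i < m}
      in \<lparr> pverts = {..<m} <+> {..<m}, parcs = A \<union> A\<inverse> \<rparr>)"

definition broken_sun_graph :: "'a pair_pre_digraph \<Rightarrow> bool" where
  "broken_sun_graph G \<longleftrightarrow>
     unicyclic G \<and>
     (\<exists>m H. m \<ge> 3 \<and> subgraph (with_proj H) (with_proj (sun_graph m)) \<and>
        digraph_iso (with_proj G) (with_proj H))"

definition perfect_matching :: "'a pair_pre_digraph \<Rightarrow> 'a set set \<Rightarrow> bool" where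
  "perfect_matching G M \<longleftrightarrow> M \<subseteq> uedges G \<and> (\<forall>v \<in> pverts G. \<exists>!e. e \<in> M \<and> v \<in> e)"

text \<open>
  The matrices of \<open>G\<close> with respect to a labelling \<open>v 0, \<dots>, v (n - 1)\<close> of its vertices.
\<close>

definition degree_mat :: "'a pair_pre_digraph \<Rightarrow> (nat \<Rightarrow> 'a) \<Rightarrow> nat \<Rightarrow> real mat" where
  "degree_mat G v n =
     mat n n (\<lambda>(i, j). if i = j then real (out_degree (with_proj G) (v i)) else 0)"

definition adjacency_mat :: "'a pair_pre_digraph \<Rightarrow> (nat \<Rightarrow> 'a) \<Rightarrow> nat \<Rightarrow> real mat" where
  "adjacency_mat G v n = mat n n (\<lambda>(i, j). if (v i, v j) \<in> parcs G then 1 else 0)"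

definition laplacian_mat :: "'a pair_pre_digraph \<Rightarrow> (nat \<Rightarrow> 'a) \<Rightarrow> nat \<Rightarrow> real mat" where
  "laplacian_mat G v n = degree_mat G v n - adjacency_mat G v n"

end

theory Submission
  imports Defs
begin

text \<open>
  Eliminating the pendant vertices turns the eigenvalue equation into a second-order recurrence along
  the cycle: \<open>a (i + 1) = 2 * a i - a (i - 1)\<close> if vertex \<open>i\<close> has a pendant, \<open>a (i + 1) = - a (i - 1)\<close>
  otherwise. The perfect matching uses every pendant edge, and so matches the remaining cycle
  vertices along the cycle. The pattern of signs that flips exactly across matched cycle edges then
  solves the recurrence. It closes up around the cycle if and only if a nonzero periodic solution exists.
\<close>

section \<open>The recurrence along the cycle\<close>

text \<open>\<open>F i\<close> stands for: the cycle edge from position \<open>i\<close> to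
  \<open>i + 1\<close> is matched. Positions run over all naturals, winding around the cycle, so
  closing up becomes periodicity.\<close>

primrec alt_sign :: "(nat \<Rightarrow> bool) \<Rightarrow> nat \<Rightarrow> real" where
  "alt_sign F 0 = 1"
| "alt_sign F (Suc i) = (if F i then - alt_sign F i else alt_sign F i)"

lemma alt_sign_cases: "alt_sign F i = 1 \<or> alt_sign F i = - 1"
  by (induction i) auto

text \<open>One full turn multiplies the pattern by \<open>alt_sign F m\<close>, so it closes up
  exactly when this sign is 1.\<close>

lemma alt_sign_add_period:
  assumes "\<And>i. F (i + m) = F i"
  shows "alt_sign F (i + m) = alt_sign F m * alt_sign F i"
  using assms by (induction i) auto

definition cycle_rec :: "(nat \<Rightarrow> bool) \<Rightarrow> (nat \<Rightarrow> real) \<Rightarrow> bool" where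
  "cycle_rec S a \<longleftrightarrow>
     (\<forall>i. a (Suc (Suc i)) = (if S (Suc i) then 2 * a (Suc i) - a i else - a i))"

text \<open>\<open>S i\<close> says that cycle vertex \<open>i\<close> carries a pendant. The cycle
  edges at vertex \<open>Suc i\<close> have the indices \<open>i\<close> and \<open>Suc i\<close>:
  none is matched if there is a pendant, exactly one otherwise.\<close>

locale cycle_matching =
  fixes m :: nat and S F :: "nat \<Rightarrow> bool"
  assumes period: "F (i + m) = F i"
    and pendant: "S (Suc i) \<Longrightarrow> \<not> F i \<and> \<not> F (Suc i)"
    and no_pendant: "\<not> S (Suc i) \<Longrightarrow> F i \<noteq> F (Suc i)"
begin

text \<open>Around a pendant vertex three consecutive signs agree, and \<open>2 * a - a = a\<close>.
  Elsewhere exactly one of the two edges flips, so the outer signs are opposite.\<close>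

lemma cycle_rec_alt_sign: "cycle_rec S (alt_sign F)"
  unfolding cycle_rec_def
proof
  fix i show "alt_sign F (Suc (Suc i)) =
      (if S (Suc i) then 2 * alt_sign F (Suc i) - alt_sign F i else - alt_sign F i)"
    using pendant[of i] no_pendant[of i] by auto
qed

text \<open>
  If the sign pattern fails to close up, multiply a periodic solution by it. The product \<open>z\<close> is
  antiperiodic, and its increments are constant up to a sign that is itself periodic. So they
  vanish, \<open>z\<close> is constant, and antiperiodicity makes it zero.
\<close>
lemma alt_sign_period:
  assumes rec: "cycle_rec S a" and per: "\<And>i. a (i + m) = a i" and nz: "a j \<noteq> 0"
  shows "alt_sign F (i + m) = alt_sign F i"
proof (cases "alt_sign F m = 1")
  case True
  then show ?thesis using alt_sign_add_period[of F m, OF period] by simp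
next
  case False
  then have m: "alt_sign F m = - 1" using alt_sign_cases by blast
  define y where "y = alt_sign F"
  define z where "z i = a i * y i" for i
  define D where "D i = (if F i then z i - z (Suc i) else z (Suc i) - z i)" for i
  have z_anti: "z (i + m) = - z i" for i
    using alt_sign_add_period[of F m i, OF period] m per[of i] by (simp add: z_def y_def)
  \<comment> \<open>At a pendant vertex nothing flips and \<open>z\<close> continues an arithmetic
    progression. Elsewhere the recurrence and the single flip give
    \<open>z (Suc (Suc i)) = z i\<close>, and the case distinction in \<open>D\<close> absorbs the
    reversed increment.\<close>
  have "D (Suc i) = D i" for i
  proof -
    have "a (Suc (Suc i)) = (if S (Suc i) then 2 * a (Suc i) - a i else - a i)"
      using rec by (simp add: cycle_rec_def)
    then show ?thesis
      using pendant[of i] no_pendant[of i]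
      by (cases "S (Suc i)"; cases "F i")
        (auto simp: D_def z_def y_def left_diff_distrib)
  qed
  then have D_const: "D i = D 0" for i by (induction i) auto
  have "D (0 + m) = - D 0"
    using z_anti[of 0] z_anti[of "Suc 0"] period[of 0] by (auto simp: D_def)
  then have "D i = 0" for i using D_const[of m] D_const[of i] by simp
  then have "z (Suc i) = z i" for i
    using D_def[of i] by (simp split: if_splits)
  then have "z i = z 0" for i by (induction i) auto
  then have "z j = 0" using z_anti[of j] by (metis neg_equal_zero)
  then show ?thesis using nz alt_sign_cases[of F j] by (auto simp: z_def y_def)
qed

end

section \<open>The Laplacian eigenvalue equation\<close>

lemma out_degree_with_proj: "out_degree (with_proj G) u = card (parcs G `` {u})"
proof -
  have "out_arcs (with_proj G) u = Pair u ` (parcs G `` {u})" by auto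
  then show ?thesis by (simp add: out_degree_def card_image inj_on_def)
qed

lemma laplacian_mat_dim [simp]:
  "laplacian_mat G v n \<in> carrier_mat n n"
  "dim_row (laplacian_mat G v n) = n" "dim_col (laplacian_mat G v n) = n"
  by (auto simp: laplacian_mat_def degree_mat_def adjacency_mat_def)

lemma laplacian_mult_vec:
  assumes bij: "bij_betw v {..<n} (pverts G)" and wf: "pair_wf_digraph G" and i: "i < n"
  shows "(laplacian_mat G v n *\<^sub>v vec n (\<lambda>i. x (v i))) $ i =
     real (card (parcs G `` {v i})) * x (v i) - (\<Sum>w\<in>parcs G `` {v i}. x w)"
proof -
  have fin: "finite (pverts G)" using bij bij_betw_finite by blast
  have sub: "parcs G `` {v i} \<subseteq> pverts G"
    using wf by (auto dest: pair_wf_digraph.wellformed')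
  have "(laplacian_mat G v n *\<^sub>v vec n (\<lambda>i. x (v i))) $ i =
     (\<Sum>j<n. ((if i = j then real (card (parcs G `` {v i})) else 0)
        - (if (v i, v j) \<in> parcs G then 1 else 0)) * x (v j))"
    using i unfolding laplacian_mat_def degree_mat_def adjacency_mat_def out_degree_with_proj
    by (simp add: scalar_prod_def lessThan_atLeast0)
  also have "\<dots> = (\<Sum>j<n. (if i = j then real (card (parcs G `` {v i})) * x (v j) else 0))
      - (\<Sum>j<n. if (v i, v j) \<in> parcs G then x (v j) else 0)"
    unfolding sum_subtractf[symmetric] by (rule sum.cong) (auto simp: left_diff_distrib)
  also have "(\<Sum>j<n. (if i = j then real (card (parcs G `` {v i})) * x (v j) else 0))
      = real (card (parcs G `` {v i})) * x (v i)"
    using i by simp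
  also have "(\<Sum>j<n. if (v i, v j) \<in> parcs G then x (v j) else 0)
      = (\<Sum>w\<in>pverts G. if (v i, w) \<in> parcs G then x w else 0)"
    by (rule sum.reindex_bij_betw[OF bij])
  also have "\<dots> = (\<Sum>w\<in>parcs G `` {v i}. x w)"
    using fin sub by (subst sum.inter_filter[symmetric]) (auto intro!: sum.cong)
  finally show ?thesis .
qed

definition laplacian_eq :: "'a pair_pre_digraph \<Rightarrow> ('a \<Rightarrow> real) \<Rightarrow> real \<Rightarrow> bool" where
  "laplacian_eq G x k \<longleftrightarrow> (\<forall>u\<in>pverts G.
     real (card (parcs G `` {u})) * x u - (\<Sum>w\<in>parcs G `` {u}. x w) = k * x u)"

lemma eigenvector_laplacian_iff:
  assumes bij: "bij_betw v {..<n} (pverts G)" and wf: "pair_wf_digraph G"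
  shows "eigenvector (laplacian_mat G v n) (vec n (\<lambda>i. x (v i))) k \<longleftrightarrow>
     (\<exists>u\<in>pverts G. x u \<noteq> 0) \<and> laplacian_eq G x k"
proof -
  have V: "pverts G = v ` {..<n}" using bij by (simp add: bij_betw_def)
  have "vec n (\<lambda>i. x (v i)) \<noteq> 0\<^sub>v n \<longleftrightarrow> (\<exists>u\<in>pverts G. x u \<noteq> 0)"
    by (auto simp: V vec_eq_iff)
  moreover have "laplacian_mat G v n *\<^sub>v vec n (\<lambda>i. x (v i)) = k \<cdot>\<^sub>v vec n (\<lambda>i. x (v i)) \<longleftrightarrow>
      (\<forall>i<n. (laplacian_mat G v n *\<^sub>v vec n (\<lambda>i. x (v i))) $ i = k * x (v i))"
    by (auto simp: vec_eq_iff)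
  then have "laplacian_mat G v n *\<^sub>v vec n (\<lambda>i. x (v i)) = k \<cdot>\<^sub>v vec n (\<lambda>i. x (v i)) \<longleftrightarrow>
      laplacian_eq G x k"
    by (simp add: laplacian_mult_vec[OF bij wf] laplacian_eq_def V lessThan_def
        del: index_mult_mat_vec)
  ultimately show ?thesis
    by (simp add: eigenvector_def)
qed

section \<open>Transport along an isomorphism\<close>

definition map_graph :: "('a \<Rightarrow> 'b) \<Rightarrow> 'a pair_pre_digraph \<Rightarrow> 'b pair_pre_digraph" where
  "map_graph h G = \<lparr> pverts = h ` pverts G, parcs = map_prod h h ` parcs G \<rparr>"

lemma map_graph_simps [simp]:
  "pverts (map_graph h G) = h ` pverts G"
  "parcs (map_graph h G) = map_prod h h ` parcs G"
  by (simp_all add: map_graph_def)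

context
  fixes G :: "'a pair_pre_digraph" and h :: "'a \<Rightarrow> 'b"
  assumes wf: "pair_wf_digraph G" and inj: "inj_on h (pverts G)"
begin

lemma arc_map_graph_iff:
  assumes "u \<in> pverts G" "w \<in> pverts G"
  shows "(h u, h w) \<in> parcs (map_graph h G) \<longleftrightarrow> (u, w) \<in> parcs G"
proof
  assume "(h u, h w) \<in> parcs (map_graph h G)"
  then obtain a b where "(a, b) \<in> parcs G" "h u = h a" "h w = h b" by auto
  then show "(u, w) \<in> parcs G"
    using assms inj_onD[OF inj] pair_wf_digraph.wellformed'[OF wf] by metis
qed force

lemma nbrs_map_graph:
  assumes "u \<in> pverts G"
  shows "parcs (map_graph h G) `` {h u} = h ` (parcs G `` {u})"
proof (intro equalityI subsetI)
  fix q assume "q \<in> parcs (map_graph h G) `` {h u}"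
  then obtain a b where ab: "(a, b) \<in> parcs G" "h u = h a" "q = h b" by auto
  then have "u = a" using assms inj_onD[OF inj] pair_wf_digraph.wellformed'[OF wf] by metis
  then show "q \<in> h ` (parcs G `` {u})" using ab by blast
qed force

text \<open>The labelling moves along with the vertices, so eigenvectors transfer unchanged.\<close>

lemma laplacian_mat_map_graph:
  assumes "\<And>i. i < n \<Longrightarrow> v i \<in> pverts G"
  shows "laplacian_mat (map_graph h G) (h \<circ> v) n = laplacian_mat G v n"
proof -
  have "card (h ` (parcs G `` {v i})) = card (parcs G `` {v i})" for i
    by (intro card_image inj_on_subset[OF inj]) (use pair_wf_digraph.wellformed'[OF wf] in auto)
  then show ?thesis
    using assms unfolding laplacian_mat_def degree_mat_def adjacency_mat_def
    by (intro arg_cong2[where f = minus] cong_mat)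
      (auto simp: out_degree_with_proj nbrs_map_graph arc_map_graph_iff simp del: map_graph_simps)
qed

lemma uedges_subset_Pow: "uedges G \<subseteq> Pow (pverts G)"
  using pair_wf_digraph.wellformed'[OF wf] by (auto simp: uedges_def)

lemma uedges_map_graph: "uedges (map_graph h G) = (`) h ` uedges G"
  by (simp add: uedges_def image_image case_prod_unfold)

lemma card_uedges_map_graph: "card (uedges (map_graph h G)) = card (uedges G)"
  unfolding uedges_map_graph
  by (rule card_image) (rule inj_on_subset[OF inj_on_image_Pow[OF inj] uedges_subset_Pow])

lemma perfect_matching_map_graph:
  assumes "perfect_matching G M"
  shows "perfect_matching (map_graph h G) ((`) h ` M)"
proof -
  have M: "M \<subseteq> uedges G" and ex: "\<And>v. v \<in> pverts G \<Longrightarrow> \<exists>!e. e \<in> M \<and> v \<in> e"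
    using assms by (auto simp: perfect_matching_def)
  have mem: "h u \<in> h ` e \<longleftrightarrow> u \<in> e" if "u \<in> pverts G" "e \<in> M" for u e
    using that M uedges_subset_Pow by (intro inj_on_image_mem_iff[OF inj]) auto
  have "\<exists>!e. e \<in> (`) h ` M \<and> h u \<in> e" if u: "u \<in> pverts G" for u
  proof -
    obtain e where e: "e \<in> M" "u \<in> e" and uniq: "\<And>e'. e' \<in> M \<Longrightarrow> u \<in> e' \<Longrightarrow> e' = e"
      using ex[OF u] by blast
    show ?thesis
    proof (rule ex1I[of _ "h ` e"])
      show "h ` e \<in> (`) h ` M \<and> h u \<in> h ` e" using e by blast
      show "d = h ` e" if "d \<in> (`) h ` M \<and> h u \<in> d" for d
        using that mem[OF u] uniq by blast
    qed
  qed
  then show ?thesis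
    using M by (auto simp: perfect_matching_def uedges_map_graph)
qed

end

section \<open>Normal form of broken sun graphs\<close>

text \<open>Normal form of a broken sun graph: \<open>T\<close> is the set of cycle positions that
  keep their pendant.\<close>

definition broken_sun :: "nat \<Rightarrow> nat set \<Rightarrow> (nat + nat) pair_pre_digraph" where
  "broken_sun m T = \<lparr> pverts = {..<m} <+> T,
     parcs = parcs (sun_graph m) \<inter> ({..<m} <+> T) \<times> ({..<m} <+> T) \<rparr>"

lemma parcs_sun_graph:
  "(p, q) \<in> parcs (sun_graph m) \<longleftrightarrow>
     (\<exists>i<m. p = Inl i \<and> q = Inl (Suc i mod m) \<or> q = Inl i \<and> p = Inl (Suc i mod m) \<or>
            p = Inl i \<and> q = Inr i \<or> q = Inl i \<and> p = Inr i)"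
  by (auto simp: sun_graph_def Let_def)

text \<open>
  Each vertex of the sun graph owns one edge, and every edge is owned by one of its ends. A subgraph
  with as many edges as vertices must therefore contain the edge owned by each of its vertices.
\<close>
fun sun_edge :: "nat \<Rightarrow> nat + nat \<Rightarrow> (nat + nat) set" where
  "sun_edge m (Inl i) = {Inl i, Inl (Suc i mod m)}"
| "sun_edge m (Inr i) = {Inr i, Inl i}"

text \<open>Following owned edges from any vertex leads to the cycle and then all the way around it.
  Every sun graph arc between present vertices is owned by one of them, so \<open>H\<close> is an
  induced subgraph.\<close>

lemma sun_subgraph_eq_broken_sun:
  assumes wf: "pair_wf_digraph H" and sym: "sym (parcs H)"
    and V: "pverts H \<subseteq> pverts (sun_graph m)" and A: "parcs H \<subseteq> parcs (sun_graph m)"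
    and ne: "pverts H \<noteq> {}" and card: "card (uedges H) = card (pverts H)"
  shows "\<exists>T\<subseteq>{..<m}. H = broken_sun m T"
proof -
  have V': "pverts H \<subseteq> {..<m} <+> {..<m}" using V by (simp add: sun_graph_def Let_def)
  then have fin: "finite (pverts H)" by (rule finite_subset) simp
  have own: "\<exists>x \<in> {p, q}. {p, q} = sun_edge m x" if "(p, q) \<in> parcs (sun_graph m)" for p q
    using that unfolding parcs_sun_graph by auto
  have "uedges H \<subseteq> sun_edge m ` pverts H"
  proof
    fix e assume "e \<in> uedges H"
    then obtain p q where e: "e = {p, q}" "(p, q) \<in> parcs H" by (auto simp: uedges_def)
    then show "e \<in> sun_edge m ` pverts H"
      using own[of p q] A pair_wf_digraph.wellformed'[OF wf e(2)] by auto
  qed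
  \<comment> \<open>The image has at most \<open>card (pverts H)\<close> elements, which is the
    number of edges, so the inclusion is an equality.\<close>
  then have "uedges H = sun_edge m ` pverts H"
    using card_image_le[OF fin] card fin by (intro card_seteq) auto
  moreover have arc: "(p, q) \<in> parcs H" if "{p, q} \<in> uedges H" for p q
    using that symD[OF sym] by (auto simp: uedges_def doubleton_eq_iff)
  ultimately have owned: "(p, q) \<in> parcs H" if "{p, q} = sun_edge m x" "x \<in> pverts H" for p q x
    using that by blast
  have step: "Inl (Suc i mod m) \<in> pverts H" if "Inl i \<in> pverts H" for i
    using owned[OF _ that] pair_wf_digraph.wellformed'[OF wf] by auto
  have "\<exists>i. Inl i \<in> pverts H"
  proof -
    obtain x where x: "x \<in> pverts H" using ne by blast
    show ?thesis
    proof (cases x)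
      case (Inr i)
      then have "(Inr i, Inl i) \<in> parcs H" using owned[of "Inr i" "Inl i" x] x by auto
      then show ?thesis using pair_wf_digraph.wellformed'[OF wf] by blast
    qed (use x in auto)
  qed
  then obtain i where i: "Inl i \<in> pverts H" by blast
  then have im: "i < m" using V' by auto
  have shift: "Inl ((i + k) mod m) \<in> pverts H" for k
  proof (induction k)
    case 0 then show ?case using i im by simp
  next
    case (Suc k) then show ?case using step[OF Suc] by (simp add: mod_Suc_eq)
  qed
  \<comment> \<open>Going \<open>j + (m - i)\<close> steps from \<open>i\<close> ends at
    \<open>j + m\<close>, which is \<open>j\<close> modulo \<open>m\<close>.\<close>
  have cyc: "Inl j \<in> pverts H" if "j < m" for j
    using shift[of "j + (m - i)"] that im by (simp add: mod_add_self2)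
  define T where "T = {j. Inr j \<in> pverts H}"
  have T: "T \<subseteq> {..<m}" using V' by (auto simp: T_def)
  have VH: "pverts H = {..<m} <+> T"
    using V' cyc unfolding T_def by (auto elim!: PlusE)
  have "parcs H = parcs (broken_sun m T)"
  proof (intro equalityI subrelI)
    fix p q assume "(p, q) \<in> parcs H"
    then show "(p, q) \<in> parcs (broken_sun m T)"
      using A pair_wf_digraph.wellformed'[OF wf, of p q] VH by (auto simp: broken_sun_def)
  next
    fix p q assume "(p, q) \<in> parcs (broken_sun m T)"
    then have "(p, q) \<in> parcs (sun_graph m)" "p \<in> pverts H" "q \<in> pverts H"
      by (auto simp: broken_sun_def VH)
    then show "(p, q) \<in> parcs H" using own[of p q] owned by blast
  qed
  then have "H = broken_sun m T" using VH by (simp add: broken_sun_def)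
  then show ?thesis using T by blast
qed

lemma broken_sun_graph_normal_form:
  assumes "broken_sun_graph G"
  shows "pair_wf_digraph G \<and> (\<exists>m T h. m \<ge> 3 \<and> T \<subseteq> {..<m} \<and> inj_on h (pverts G) \<and>
     map_graph h G = broken_sun m T)"
proof -
  from assms obtain m H where G: "unicyclic G" and m: "m \<ge> 3"
    and sub: "subgraph (with_proj H) (with_proj (sun_graph m))"
    and iso: "digraph_iso (with_proj G) (with_proj H)"
    by (auto simp: broken_sun_graph_def)
  interpret pair_graph G using G by (simp add: unicyclic_def)
  have wf: "pair_wf_digraph G" by unfold_locales
  obtain f where f: "pre_digraph.digraph_isomorphism (with_proj G) f"
    and Hf: "with_proj H = app_iso f (with_proj G)"
    using iso by (auto simp: digraph_iso_def)
  define h where "h = iso_verts f"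
  have inj: "inj_on h (pverts G)"
    using f by (auto simp: pre_digraph.digraph_isomorphism_def h_def)
  \<comment> \<open>Under \<open>with_proj\<close> the ends of an arc are its components, which
    forces \<open>iso_arcs f\<close> to apply \<open>h\<close> to both.\<close>
  have ft: "iso_tail f = fst" "iso_head f = snd"
    using arg_cong[OF Hf, of tail] arg_cong[OF Hf, of head] by simp_all
  have fa: "iso_arcs f a = map_prod h h a" if "a \<in> parcs G" for a
    using f that by (auto simp: pre_digraph.digraph_isomorphism_def h_def ft prod_eq_iff)
  have HG: "H = map_graph h G"
    using arg_cong[OF Hf, of verts] arg_cong[OF Hf, of arcs] fa
    by (intro pair_pre_digraph.equality) (auto simp: h_def)
  have symG: "sym (parcs G)" using pair_sym_arcs by (simp add: symmetric_def)
  have "\<exists>T\<subseteq>{..<m}. H = broken_sun m T"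
  proof (rule sun_subgraph_eq_broken_sun)
    show "pair_wf_digraph H"
      unfolding HG by unfold_locales (auto dest: wellformed')
    show "sym (parcs H)" using symG by (auto simp: HG intro!: symI dest: symD)
    show "pverts H \<subseteq> pverts (sun_graph m)" "parcs H \<subseteq> parcs (sun_graph m)"
      using sub by (auto simp: subgraph_def)
    \<comment> \<open>Connectedness includes that there is a vertex.\<close>
    show "pverts H \<noteq> {}"
      using G by (auto simp: HG unicyclic_def Digraph_Component.connected_def strongly_connected_def)
    show "card (uedges H) = card (pverts H)"
      using G by (simp add: HG card_uedges_map_graph[OF wf inj] card_image[OF inj] unicyclic_def
          del: map_graph_simps(2))
  qed
  then show ?thesis using wf m inj HG by metis
qed

section \<open>Broken sun graphs in normal form\<close>

lemma parcs_sun_graph_cycle: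
  "(Inl a, Inl b) \<in> parcs (sun_graph m) \<longleftrightarrow> a < m \<and> b < m \<and> (b = Suc a mod m \<or> a = Suc b mod m)"
  unfolding parcs_sun_graph by auto

lemma parcs_sun_graph_pendant:
  "(Inl a, Inr b) \<in> parcs (sun_graph m) \<longleftrightarrow> a < m \<and> a = b"
  unfolding parcs_sun_graph by auto

lemma Suc_mod_eq_iff: "Suc i mod m = Suc j mod m \<longleftrightarrow> i mod m = j mod (m::nat)"
  by (auto simp: mod_Suc)

locale broken_sun_nf =
  fixes m :: nat and T :: "nat set"
  assumes m3: "m \<ge> 3" and T: "T \<subseteq> {..<m}"
begin

abbreviation "B \<equiv> broken_sun m T"

lemma wf_B: "pair_wf_digraph B"
  by unfold_locales (auto simp: broken_sun_def)

lemma pverts_B: "pverts B = {..<m} <+> T"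
  by (simp add: broken_sun_def)

lemma nbrs_pendant:
  assumes "i \<in> T" shows "parcs B `` {Inr i} = {Inl i}"
  using assms T by (auto simp: broken_sun_def parcs_sun_graph)

text \<open>Centring at \<open>Suc i\<close> makes the predecessor \<open>i mod m\<close>, without
  subtraction modulo \<open>m\<close>.\<close>

lemma nbrs_cycle:
  "parcs B `` {Inl (Suc i mod m)} =
     {Inl (i mod m), Inl (Suc (Suc i) mod m)} \<union> Inr ` (T \<inter> {Suc i mod m})" (is "_ = ?R")
proof (rule Set.set_eqI)
  fix q
  show "q \<in> parcs B `` {Inl (Suc i mod m)} \<longleftrightarrow> q \<in> ?R"
  proof (cases q)
    case (Inl b)
    have "q \<in> parcs B `` {Inl (Suc i mod m)} \<longleftrightarrow>
        b < m \<and> (b = Suc (Suc i) mod m \<or> Suc b mod m = Suc i mod m)"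
      using m3 Inl by (auto simp: broken_sun_def parcs_sun_graph_cycle mod_Suc_eq)
    also have "\<dots> \<longleftrightarrow> b = Suc (Suc i) mod m \<or> b = i mod m"
      using m3 by (auto simp: Suc_mod_eq_iff)
    finally show ?thesis using Inl by auto
  next
    case (Inr b)
    then show ?thesis using m3 T by (auto simp: broken_sun_def parcs_sun_graph_pendant)
  qed
qed

text \<open>Here \<open>m \<ge> 3\<close> is essential. The distinctness yields cycle degrees 2 and
  3, and two different cycle edges at each cycle vertex.\<close>

lemma cycle_nbrs_distinct: "i mod m \<noteq> Suc (Suc i) mod m"
  using m3 by (auto simp: mod_Suc)

text \<open>The witness is the predecessor of \<open>k\<close>, raised by \<open>m\<close> so that
  the subtraction does not truncate at \<open>k = 0\<close>.\<close>

lemma cycle_vertex: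
  assumes "k < m" shows "\<exists>i. k = Suc i mod m"
  using assms by (intro exI[of _ "k + m - 1"]) auto

text \<open>A pendant \<open>p\<close> at \<open>c\<close> gives \<open>x p - x c = 2 * x p\<close>.
  Substituting \<open>x p = - x c\<close> into the equation at a cycle vertex, of degree 3 or 2,
  leaves the recurrence.\<close>

lemma laplacian_eq_two_iff:
  "laplacian_eq B x 2 \<longleftrightarrow> (\<forall>i\<in>T. x (Inr i) = - x (Inl i)) \<and>
     cycle_rec (\<lambda>i. i mod m \<in> T) (\<lambda>i. x (Inl (i mod m)))"
proof -
  have pend: "real (card (parcs B `` {Inr i})) * x (Inr i) - (\<Sum>w\<in>parcs B `` {Inr i}. x w) = 2 * x (Inr i)
      \<longleftrightarrow> x (Inr i) = - x (Inl i)" if "i \<in> T" for i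
    by (auto simp: nbrs_pendant[OF that])
  have cyc: "real (card (parcs B `` {Inl (Suc i mod m)})) * x (Inl (Suc i mod m))
       - (\<Sum>w\<in>parcs B `` {Inl (Suc i mod m)}. x w) = 2 * x (Inl (Suc i mod m))
      \<longleftrightarrow> x (Inl (Suc (Suc i) mod m)) =
        (if Suc i mod m \<in> T then 2 * x (Inl (Suc i mod m)) - x (Inl (i mod m)) else - x (Inl (i mod m)))"
    if p: "\<forall>i\<in>T. x (Inr i) = - x (Inl i)" for i
    using p cycle_nbrs_distinct[of i] by (auto simp: nbrs_cycle card_insert_if)
  have "laplacian_eq B x 2 \<longleftrightarrow> (\<forall>i\<in>T. x (Inr i) = - x (Inl i)) \<and>
     (\<forall>i. real (card (parcs B `` {Inl (Suc i mod m)})) * x (Inl (Suc i mod m))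
       - (\<Sum>w\<in>parcs B `` {Inl (Suc i mod m)}. x w) = 2 * x (Inl (Suc i mod m)))"
    (is "_ \<longleftrightarrow> _ \<and> (\<forall>i. ?C (Suc i mod m))")
  proof -
    have "(\<forall>k<m. ?C k) \<longleftrightarrow> (\<forall>i. ?C (Suc i mod m))"
      using cycle_vertex m3 by fastforce
    then show ?thesis using pend by (auto simp: laplacian_eq_def pverts_B)
  qed
  then show ?thesis using cyc by (auto simp: cycle_rec_def)
qed

text \<open>A pendant can only be covered by its own edge, which excludes both cycle edges at its
  neighbour. A cycle vertex without a pendant has only its two cycle edges to be covered by.\<close>

lemma cycle_matching_of_perfect_matching:
  assumes "perfect_matching B M"
  shows "cycle_matching m (\<lambda>i. i mod m \<in> T) (\<lambda>i. {Inl (i mod m), Inl (Suc i mod m)} \<in> M)"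
proof -
  have M: "M \<subseteq> uedges B" and ex: "\<And>u. u \<in> pverts B \<Longrightarrow> \<exists>!e. e \<in> M \<and> u \<in> e"
    using assms by (auto simp: perfect_matching_def)
  have symB: "(q, p) \<in> parcs B" if "(p, q) \<in> parcs B" for p q
    using that by (auto simp: broken_sun_def parcs_sun_graph)
  have edge: "\<exists>q \<in> parcs B `` {p}. e = {p, q}" if e: "e \<in> M" "p \<in> e" for p e
  proof -
    obtain a b where "(a, b) \<in> parcs B" "e = {a, b}"
      using e(1) M unfolding uedges_def by fast
    then show ?thesis using e(2) symB by blast
  qed
  have pend: "{Inr i, Inl i} \<in> M" if "i \<in> T" for i
  proof -
    have "Inr i \<in> pverts B" using that by (auto simp: pverts_B)
    then obtain e where "e \<in> M" "Inr i \<in> e" using ex by blast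
    then show ?thesis using edge[of e "Inr i"] nbrs_pendant[OF that] by auto
  qed
  show ?thesis
  proof
    fix i
    let ?p = "Inl (Suc i mod m) :: nat + nat"
    have P: "?p \<in> pverts B" using m3 by (auto simp: pverts_B)
    have uniq: "e = e'" if "e \<in> M" "e' \<in> M" "?p \<in> e" "?p \<in> e'" for e e'
      using ex[OF P] that by blast
    show "({Inl ((i + m) mod m), Inl (Suc (i + m) mod m)} \<in> M) =
        ({Inl (i mod m), Inl (Suc i mod m)} \<in> M)"
      by (metis add_Suc mod_add_self2)
    show "{Inl (i mod m), Inl (Suc i mod m)} \<notin> M \<and>
        {Inl (Suc i mod m), Inl (Suc (Suc i) mod m)} \<notin> M" if "Suc i mod m \<in> T"
      using uniq[OF pend[OF that]] by (auto simp: doubleton_eq_iff)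
    show "({Inl (i mod m), Inl (Suc i mod m)} \<in> M) \<noteq>
        ({Inl (Suc i mod m), Inl (Suc (Suc i) mod m)} \<in> M)" if "Suc i mod m \<notin> T"
    proof -
      obtain e where e: "e \<in> M" "?p \<in> e" using ex[OF P] by blast
      then have "e = {Inl (i mod m), ?p} \<or> e = {?p, Inl (Suc (Suc i) mod m)}"
        using edge[OF e] that by (auto simp: nbrs_cycle)
      moreover have "{Inl (i mod m), ?p} \<noteq> {?p, Inl (Suc (Suc i) mod m)}"
        using cycle_nbrs_distinct[of i] by (auto simp: doubleton_eq_iff)
      ultimately show ?thesis using uniq e(1) by blast
    qed
  qed
qed

lemma sign_solution:
  assumes "perfect_matching B M" and "laplacian_eq B x 2" and "\<exists>u\<in>pverts B. x u \<noteq> 0"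
  shows "\<exists>y. laplacian_eq B y 2 \<and> (\<forall>u. y u \<in> {- 1, 1})"
proof -
  define F where "F i \<longleftrightarrow> {Inl (i mod m), Inl (Suc i mod m)} \<in> M" for i
  interpret cycle_matching m "\<lambda>i. i mod m \<in> T" F
    unfolding F_def[abs_def] by (rule cycle_matching_of_perfect_matching[OF assms(1)])
  have rec: "cycle_rec (\<lambda>i. i mod m \<in> T) (\<lambda>i. x (Inl (i mod m)))"
    and p: "\<forall>i\<in>T. x (Inr i) = - x (Inl i)"
    using assms(2) by (auto simp: laplacian_eq_two_iff)
  \<comment> \<open>Pendant values are negatives of cycle values, so \<open>x\<close> cannot vanish
    on the whole cycle.\<close>
  obtain j where "j < m" "x (Inl j) \<noteq> 0"
    using assms(3) p T by (auto simp: pverts_B)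
  then have per: "alt_sign F (i + m) = alt_sign F i" for i
    using alt_sign_period[OF rec, of j] by simp
  have mult: "alt_sign F (i + k * m) = alt_sign F i" for i k
  proof (induction k)
    case (Suc k)
    then show ?case using per[of "i + k * m"] by (simp add: add.assoc add.commute[of m])
  qed simp
  \<comment> \<open>The normal form stores one value per residue, whereas
    \<open>cycle_rec_alt_sign\<close> concerns unreduced indices.\<close>
  have "alt_sign F (i mod m) = alt_sign F i" for i
    using mult[of "i mod m" "i div m"] by (simp add: mod_div_mult_eq)
  then have "laplacian_eq B (case_sum (alt_sign F) (\<lambda>i. - alt_sign F i)) 2"
    using cycle_rec_alt_sign by (simp add: laplacian_eq_two_iff)
  moreover have "case_sum (alt_sign F) (\<lambda>i. - alt_sign F i) u \<in> {- 1, 1}" for u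
  proof (cases u)
    case (Inl i) then show ?thesis using alt_sign_cases[of F i] by auto
  next
    case (Inr i) then show ?thesis using alt_sign_cases[of F i] by auto
  qed
  ultimately show ?thesis by blast
qed

end

theorem theorem4:
  fixes G :: "'a pair_pre_digraph" and v :: "nat \<Rightarrow> 'a" and n :: nat
  assumes "broken_sun_graph G"
    and "bij_betw v {..<n} (pverts G)"
    and "\<exists>M. perfect_matching G M"
    and "eigenvalue (laplacian_mat G v n) 2"
  shows "\<exists>r X. r \<noteq> 0 \<and> eigenvector (laplacian_mat G v n) X 2 \<and> (\<forall>i<n. X $ i \<in> {- r, r})"
proof -
  obtain m T h where wf: "pair_wf_digraph G" and m: "m \<ge> 3" "T \<subseteq> {..<m}"
    and inj: "inj_on h (pverts G)" and hG: "map_graph h G = broken_sun m T"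
    using broken_sun_graph_normal_form[OF assms(1)] by blast
  interpret broken_sun_nf m T using m by unfold_locales
  have "v i \<in> pverts G" if "i < n" for i using assms(2) that by (auto simp: bij_betw_def)
  then have L: "laplacian_mat G v n = laplacian_mat B (h \<circ> v) n"
    unfolding hG[symmetric] by (rule laplacian_mat_map_graph[OF wf inj, symmetric])
  have "bij_betw h (pverts G) (pverts B)"
    using inj by (simp add: bij_betw_def hG[symmetric])
  then have bij: "bij_betw (h \<circ> v) {..<n} (pverts B)"
    using assms(2) bij_betw_trans by blast
  obtain M where M: "perfect_matching B M"
    using assms(3) perfect_matching_map_graph[OF wf inj] hG by metis
  obtain X where X: "eigenvector (laplacian_mat B (h \<circ> v) n) X 2"
    using assms(4) by (auto simp: L eigenvalue_def)
  \<comment> \<open>The entries of \<open>X\<close> are read back as a function on vertices by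
    inverting the labelling.\<close>
  define x where "x u = X $ inv_into {..<n} (h \<circ> v) u" for u
  have "X = vec n (\<lambda>i. x ((h \<circ> v) i))"
    using X bij inv_into_f_f[of "h \<circ> v" "{..<n}"]
    by (auto simp: eigenvector_def x_def bij_betw_def vec_eq_iff simp del: o_apply)
  then have x: "\<exists>u\<in>pverts B. x u \<noteq> 0" "laplacian_eq B x 2"
    using X eigenvector_laplacian_iff[OF bij wf_B, of x 2] by auto
  obtain y where y: "laplacian_eq B y 2" "\<And>u. y u \<in> {- 1, 1}"
    using sign_solution[OF M x(2,1)] by blast
  have "\<exists>u\<in>pverts B. y u \<noteq> 0"
    using x(1) y(2) by (metis empty_iff insert_iff neg_equal_0_iff_equal zero_neq_one)
  then have "eigenvector (laplacian_mat G v n) (vec n (\<lambda>i. y ((h \<circ> v) i))) 2"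
    using y(1) eigenvector_laplacian_iff[OF bij wf_B, of y 2] by (simp add: L)
  then show ?thesis
    using y(2) by (intro exI[of _ 1] exI[of _ "vec n (\<lambda>i. y ((h \<circ> v) i))"]) auto
qed

end
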